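(* For every $x=(x_C,x_U)\in\mathbb{B}^n$, $$\max_{y\in\mathcal{U}(x)} f(y)=\sum_{i\in C}c_i x_i+\sum_{i\in U}\frac{c_i+|c_i|}{2},$$ and for every $j\in J$, $$\max_{y\in\mathcal{U}(x)} g_j(y)=\sum_{i\in C}a_{ij}x_i+\sum_{i\in U}\frac{a_{ij}+|a_{ij}|}{2}.$$
   Context: Let $n,m$ be positive integers, $I=\{1,\dots,n\}$, $J=\{1,\dots,m\}$, and $\mathbb{B}^n=\{0,1\}^n$. Let $c_i\in\mathbb{R}$ for $i\in I$ and $a_{ij}\in\mathbb{R}$ for $i\in I$, $j\in J$. Define $f:\mathbb{B}^n\to\mathbb{R}$ by $f(x)=\sum_{i=1}^n c_i x_i$ and $g_j:\mathbb{B}^n\to\mathbb{R}$ by $g_j(x)=\sum_{i=1}^n a_{ij}x_i$ for $j\in J$. The index set $I$ is partitioned into given sets $C=\{1,\dots,c\}$ (indices of deterministic variables) and $U=\{c+1,\dots,n\}$ (indices of uncertain variables), where $0\le c<n$ is an integer index bound (not to be confused with the coefficients $c_i$). A vector $x\in\mathbb{B}^n$ is written $x=(x_C,x_U)$ with $x_C=(x_i)_{i\in C}$ and $x_U=(x_i)_{i\in U}$. The set of implemented outcomes associated with $x$ is $\mathcal{U}(x)=\{\tilde x=(\tilde x_C,\tilde x_U)\in\mathbb{B}^n:\tilde x_C=x_C\}$. *)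

theory Defs
  imports Complex_Main "HOL-Library.FuncSet"
begin

text \<open>
  A vector of length \<open>n\<close> is a function on the index set \<open>{1..n}\<close>. Binary vectors are
  taken extensional (undefined outside \<open>{1..n}\<close>), so that each one has exactly
  one representative and the set of all of them is finite; this makes the use of
  \<^const>\<open>Max\<close> over sets of outcomes meaningful.
\<close>

definition binary_vectors :: "nat \<Rightarrow> (nat \<Rightarrow> real) set" where
  "binary_vectors n = {1..n} \<rightarrow>\<^sub>E {0, 1}"

definition linear_function :: "nat \<Rightarrow> (nat \<Rightarrow> real) \<Rightarrow> (nat \<Rightarrow> real) \<Rightarrow> real" where
  "linear_function n b x = (\<Sum>i = 1..n. b i * x i)"

text \<open>
  The parameter \<open>k\<close> is the index bound separating the deterministic from the
  uncertain variables (written \<open>c\<close> informally, which would clash with the coefficients).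
\<close>

definition deterministic_indices :: "nat \<Rightarrow> nat set" where
  "deterministic_indices k = {1..k}"

definition uncertain_indices :: "nat \<Rightarrow> nat \<Rightarrow> nat set" where
  "uncertain_indices n k = {k + 1..n}"

definition implemented_outcomes :: "nat \<Rightarrow> nat \<Rightarrow> (nat \<Rightarrow> real) \<Rightarrow> (nat \<Rightarrow> real) set" where
  "implemented_outcomes n k x =
    {y \<in> binary_vectors n. \<forall>i\<in>deterministic_indices k. y i = x i}"

lemma finite_binary_vectors: "finite (binary_vectors n)"
  by (simp add: binary_vectors_def finite_PiE)

lemma finite_implemented_outcomes: "finite (implemented_outcomes n k x)"
  by (simp add: implemented_outcomes_def finite_binary_vectors)

lemma implemented_outcomes_self:
  "x \<in> binary_vectors n \<Longrightarrow> x \<in> implemented_outcomes n k x"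
  by (simp add: implemented_outcomes_def)

end

theory Submission
  imports Defs
begin

text \<open>
  On the outcomes of \<open>x\<close> the deterministic coordinates contribute a constant, while the
  uncertain ones range freely over \<open>{0, 1}\<close>. The maximum of a linear function therefore
  decouples into independent one-variable problems: \<open>t \<mapsto> b i * t\<close> has maximum
  \<open>(b i + \<bar>b i\<bar>) / 2\<close>, the positive part of \<open>b i\<close>, on \<open>{0, 1}\<close>. Adding up the one-variable
  bounds bounds every outcome, and the outcome that switches on exactly the uncertain
  coordinates with positive coefficient attains all of these bounds at once. The objective
  and the constraint functions are the same case, with different coefficients.
\<close>

lemma linear_function_split:
  assumes "k \<le> n"
  shows "linear_function n b y =
    (\<Sum>i\<in>deterministic_indices k. b i * y i) + (\<Sum>i\<in>uncertain_indices n k. b i * y i)"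
  unfolding linear_function_def deterministic_indices_def uncertain_indices_def
  using sum.ub_add_nat[of 1 k "\<lambda>i. b i * y i" "n - k"] assms by simp

lemma linear_function_implemented_outcome:
  assumes "k \<le> n" and "y \<in> implemented_outcomes n k x"
  shows "linear_function n b y =
    (\<Sum>i\<in>deterministic_indices k. b i * x i) + (\<Sum>i\<in>uncertain_indices n k. b i * y i)"
  using assms by (simp add: linear_function_split implemented_outcomes_def)

lemma mult_binary_le_pos_part:
  fixes b t :: real
  assumes "t \<in> {0, 1}"
  shows "b * t \<le> (b + \<bar>b\<bar>) / 2"
  using assms by auto

text \<open>
  A maximiser of the linear function with coefficients \<open>b\<close> over the outcomes of \<open>x\<close>.
  The value \<open>undefined\<close> outside \<open>{1..n}\<close> makes it one of the extensional vectors.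
\<close>

definition best_outcome ::
    "nat \<Rightarrow> nat \<Rightarrow> (nat \<Rightarrow> real) \<Rightarrow> (nat \<Rightarrow> real) \<Rightarrow> nat \<Rightarrow> real" where
  "best_outcome n k b x i =
    (if i \<in> deterministic_indices k then x i
     else if i \<in> uncertain_indices n k then of_bool (0 < b i)
     else undefined)"

lemma best_outcome_implemented:
  assumes "k \<le> n" and "x \<in> binary_vectors n"
  shows "best_outcome n k b x \<in> implemented_outcomes n k x"
  using assms
  by (auto simp: implemented_outcomes_def binary_vectors_def best_outcome_def
      deterministic_indices_def uncertain_indices_def PiE_iff extensional_def)

lemma best_outcome_attains_pos_part:
  assumes "i \<in> uncertain_indices n k"
  shows "b i * best_outcome n k b x i = (b i + \<bar>b i\<bar>) / 2"
  using assms
  by (auto simp: best_outcome_def deterministic_indices_def uncertain_indices_def)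

text \<open>
  The coordinatewise bounds give the upper bound, and attaining them simultaneously is
  possible because no constraint links the uncertain coordinates.
\<close>

lemma Max_linear_function_implemented_outcomes:
  assumes "k \<le> n" and x: "x \<in> binary_vectors n"
  shows "Max (linear_function n b ` implemented_outcomes n k x) =
    (\<Sum>i\<in>deterministic_indices k. b i * x i) +
    (\<Sum>i\<in>uncertain_indices n k. (b i + \<bar>b i\<bar>) / 2)"
proof (rule Max_eqI)
  show "finite (linear_function n b ` implemented_outcomes n k x)"
    by (simp add: finite_implemented_outcomes)
next
  fix v
  assume "v \<in> linear_function n b ` implemented_outcomes n k x"
  then obtain y where y: "y \<in> implemented_outcomes n k x" and v: "v = linear_function n b y"
    by blast
  have "b i * y i \<le> (b i + \<bar>b i\<bar>) / 2" if "i \<in> uncertain_indices n k" for i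
  proof (rule mult_binary_le_pos_part)
    have "i \<in> {1..n}"
      using that by (simp add: uncertain_indices_def)
    with y show "y i \<in> {0, 1}"
      unfolding implemented_outcomes_def binary_vectors_def by blast
  qed
  then show "v \<le> (\<Sum>i\<in>deterministic_indices k. b i * x i) +
      (\<Sum>i\<in>uncertain_indices n k. (b i + \<bar>b i\<bar>) / 2)"
    unfolding v linear_function_implemented_outcome[OF \<open>k \<le> n\<close> y]
    by (intro add_left_mono sum_mono)
next
  have best: "best_outcome n k b x \<in> implemented_outcomes n k x"
    using assms by (rule best_outcome_implemented)
  have "linear_function n b (best_outcome n k b x) =
      (\<Sum>i\<in>deterministic_indices k. b i * x i) +
      (\<Sum>i\<in>uncertain_indices n k. (b i + \<bar>b i\<bar>) / 2)"
    unfolding linear_function_implemented_outcome[OF \<open>k \<le> n\<close> best]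
    by (simp add: best_outcome_attains_pos_part cong: sum.cong)
  with best show "(\<Sum>i\<in>deterministic_indices k. b i * x i) +
      (\<Sum>i\<in>uncertain_indices n k. (b i + \<bar>b i\<bar>) / 2)
      \<in> linear_function n b ` implemented_outcomes n k x"
    by (metis imageI)
qed

theorem lemma3:
  fixes n m k :: nat
    and c :: "nat \<Rightarrow> real"
    and a :: "nat \<Rightarrow> nat \<Rightarrow> real"
  assumes "1 \<le> n" and "1 \<le> m" and "k < n"
  shows "\<forall>x\<in>binary_vectors n.
    Max (linear_function n c ` implemented_outcomes n k x) =
      (\<Sum>i\<in>deterministic_indices k. c i * x i) +
      (\<Sum>i\<in>uncertain_indices n k. (c i + \<bar>c i\<bar>) / 2) \<and>
    (\<forall>j\<in>{1..m}.
      Max (linear_function n (\<lambda>i. a i j) ` implemented_outcomes n k x) =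
        (\<Sum>i\<in>deterministic_indices k. a i j * x i) +
        (\<Sum>i\<in>uncertain_indices n k. (a i j + \<bar>a i j\<bar>) / 2))"
  using \<open>k < n\<close> by (simp add: Max_linear_function_implemented_outcomes)

end
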